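(* For every integer $n$ with $1\le n<14$ one has $C(n)=0$. For every integer $n\ge 14$, let $m$ be the integer such that $f_{m+1}+2f_{m-1}\le n\le f_{m+2}+2f_m-1$. Then $m\ge 3$ and $$C(n)=\begin{cases} n-f_{m+1}-f_{m-1}-m+1, & \text{if } n\le 2f_{m+1}-2;\\ f_m-m-1, & \text{otherwise.}\end{cases}$$
   Context: The Fibonacci sequence $\mathbb{F}$ is the infinite word over $\{a,b\}$ that is the fixed point beginning with $a$ of the morphism $\sigma(a)=ab$, $\sigma(b)=a$; $\mathbb{F}[1,n]$ is its prefix of length $n$. The notation $u\prec v$ means that $u$ is a factor (contiguous subword) of $v$. $C(n)=\sharp\{\omega:\omega\omega\omega\prec\mathbb{F}[1,n]\}$, where $\omega$ ranges over nonempty words, is the number of distinct cubes in $\mathbb{F}[1,n]$. The Fibonacci numbers are indexed by $f_{-2}=0$, $f_{-1}=1$, $f_{m+1}=f_m+f_{m-1}$ for $m\ge -1$ (so $f_0=1$, $f_1=2$, $f_2=3$, $f_3=5$). *)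

theory Defs
  imports "HOL-Library.Stream" "HOL-Library.Sublist" "HOL-Number_Theory.Fib"
begin

datatype letter = La | Lb

fun sigma :: "letter \<Rightarrow> letter list" where
  "sigma La = [La, Lb]"
| "sigma Lb = [La]"

(* flat (smap sigma w) is the image of the infinite word w under the morphism sigma.
   Existence and uniqueness of the fixed point are fib_word_ex1 below. *)
definition fib_word :: "letter stream" where
  "fib_word = (THE w. flat (smap sigma w) = w \<and> shd w = La)"

definition cube_count :: "nat \<Rightarrow> nat" where
  "cube_count n = card {\<omega>. \<omega> \<noteq> [] \<and> sublist (\<omega> @ \<omega> @ \<omega>) (stake n fib_word)}"

(* Indexed so that f_(-2) = 0 and f_(-1) = 1; only meaningful for m \<ge> -2. *)
definition fibnum :: "int \<Rightarrow> int" where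
  "fibnum m = int (fib (nat (m + 2)))"

lemma fibnum_rec:
  "fibnum (- 2) = 0" "fibnum (- 1) = 1"
  "m \<ge> - 1 \<Longrightarrow> fibnum (m + 1) = fibnum m + fibnum (m - 1)"
proof -
  show "fibnum (- 2) = 0" "fibnum (- 1) = 1"
    by (simp_all add: fibnum_def)
  assume "m \<ge> - 1"
  then obtain k where "m = int k - 1"
    by (metis add.commute add_diff_cancel_left' diff_ge_0_iff_ge diff_minus_eq_add nonneg_int_cases)
  then have "nat (m + 1 + 2) = Suc (Suc k)" "nat (m + 2) = Suc k" "nat (m - 1 + 2) = k"
    by auto
  then show "fibnum (m + 1) = fibnum m + fibnum (m - 1)"
    by (simp add: fibnum_def)
qed

definition sigma_list :: "letter list \<Rightarrow> letter list" where
  "sigma_list u = concat (map sigma u)"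

lemma sigma_nonempty [simp]: "sigma x \<noteq> []"
  by (cases x) auto

lemma flat_sigma_shift:
  "flat (smap sigma (u @- w)) = sigma_list u @- flat (smap sigma w)"
  by (induction u) (simp_all add: sigma_list_def)

lemma sigma_list_append: "sigma_list (u @ v) = sigma_list u @ sigma_list v"
  by (simp add: sigma_list_def)

lemma sigma_iterate_prefix:
  "\<exists>v. v \<noteq> [] \<and> (sigma_list ^^ Suc k) [La] = (sigma_list ^^ k) [La] @ v"
proof (induction k)
  case 0
  then show ?case by (simp add: sigma_list_def)
next
  case (Suc k)
  then obtain v where v: "v \<noteq> []" "(sigma_list ^^ Suc k) [La] = (sigma_list ^^ k) [La] @ v"
    by blast
  have "(sigma_list ^^ Suc (Suc k)) [La] = sigma_list ((sigma_list ^^ k) [La] @ v)"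
    using v(2) by simp
  also have "\<dots> = (sigma_list ^^ Suc k) [La] @ sigma_list v"
    by (simp add: sigma_list_append)
  finally have "(sigma_list ^^ Suc (Suc k)) [La] = (sigma_list ^^ Suc k) [La] @ sigma_list v" .
  moreover have "sigma_list v \<noteq> []"
    using v(1) by (cases v) (simp_all add: sigma_list_def)
  ultimately show ?case by blast
qed

lemma sigma_iterate_length: "length ((sigma_list ^^ k) [La]) > k"
proof (induction k)
  case (Suc k)
  obtain v where "v \<noteq> []" "(sigma_list ^^ Suc k) [La] = (sigma_list ^^ k) [La] @ v"
    using sigma_iterate_prefix by blast
  then show ?case
    using Suc by (cases v) (simp_all del: funpow.simps)
qed simp

lemma sigma_iterate_nth:
  assumes "i < length ((sigma_list ^^ k) [La])" and "k \<le> l"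
  shows "i < length ((sigma_list ^^ l) [La]) \<and>
         (sigma_list ^^ l) [La] ! i = (sigma_list ^^ k) [La] ! i"
  using assms(2)
proof (induction l rule: dec_induct)
  case base
  then show ?case using assms by simp
next
  case (step l)
  obtain v where "(sigma_list ^^ Suc l) [La] = (sigma_list ^^ l) [La] @ v"
    using sigma_iterate_prefix by blast
  then show ?case
    using step by (simp add: nth_append del: funpow.simps)
qed

lemma sigma_fixed_prefix:
  assumes "flat (smap sigma w) = w" and "shd w = La"
  shows "\<exists>r. w = (sigma_list ^^ k) [La] @- r"
proof (induction k)
  case 0
  show ?case using assms(2) by (metis funpow_0 shift.simps stream.collapse)
next
  case (Suc k)
  then obtain r where r: "w = (sigma_list ^^ k) [La] @- r"
    by blast
  have "w = flat (smap sigma ((sigma_list ^^ k) [La] @- r))"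
    using assms(1) r by simp
  also have "\<dots> = (sigma_list ^^ Suc k) [La] @- flat (smap sigma r)"
    by (simp only: flat_sigma_shift funpow.simps comp_apply)
  finally show ?case by blast
qed

lemma fib_word_ex1: "\<exists>!w. flat (smap sigma w) = w \<and> shd w = La"
proof (rule ex_ex1I)
  define P where "P = (\<lambda>k. (sigma_list ^^ k) [La])"
  define w where "w = smap (\<lambda>i. P i ! i) nats"
  have len: "length (P k) > k" for k
    unfolding P_def by (rule sigma_iterate_length)
  have nth: "w !! i = P k ! i" if "i < length (P k)" for i k
  proof -
    have "P i ! i = P k ! i"
      using sigma_iterate_nth[of i i k] sigma_iterate_nth[of i k i] that len[of i]
      unfolding P_def by (cases "i \<le> k") auto
    then show ?thesis by (simp add: w_def)
  qed
  have pre: "w = P k @- sdrop (length (P k)) w" for k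
  proof -
    have "stake (length (P k)) w = P k"
      by (rule nth_equalityI) (simp_all add: nth)
    then show ?thesis by (metis stake_sdrop)
  qed
  have "flat (smap sigma w) !! i = w !! i" for i
  proof -
    have "flat (smap sigma w) = P (Suc i) @- flat (smap sigma (sdrop (length (P i)) w))"
      using arg_cong[OF pre[of i], of "\<lambda>s. flat (smap sigma s)"]
      by (simp only: flat_sigma_shift P_def funpow.simps comp_apply)
    then show ?thesis
      using nth[of i "Suc i"] len[of "Suc i"] by (simp add: shift_snth_less)
  qed
  then have "flat (smap sigma w) = w"
    by (metis stream_smap_nats stream.map_cong)
  moreover have "shd w = La"
    by (simp add: w_def P_def)
  ultimately show "\<exists>w. flat (smap sigma w) = w \<and> shd w = La" by blast
next
  fix w w' :: "letter stream"
  assume w: "flat (smap sigma w) = w \<and> shd w = La"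
    and w': "flat (smap sigma w') = w' \<and> shd w' = La"
  have "w !! i = w' !! i" for i
  proof -
    obtain r where "w = (sigma_list ^^ i) [La] @- r"
      using sigma_fixed_prefix w by blast
    moreover obtain r' where "w' = (sigma_list ^^ i) [La] @- r'"
      using sigma_fixed_prefix w' by blast
    ultimately show ?thesis
      using sigma_iterate_length[of i] by (simp add: shift_snth_less)
  qed
  then show "w = w'"
    by (metis stream_smap_nats stream.map_cong)
qed

end

theory Submission
  imports Defs
begin

text \<open>
  The Fibonacci word is its own image under \<^term>\<open>sigma\<close>, and it can be cut back into the blocks
  \<open>ab\<close> and \<open>a\<close> in only one way, because every \<open>a\<close> opens a block. Cutting
  turns a long repetition whose period is at least \<open>2\<close> into one with a smaller period. In the
  other direction, the image of a maximal repetition can be continued to the right by exactly one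
  further letter, since both blocks begin with \<open>a\<close> and differ afterwards.

  Being a cube is not preserved by the cutting: \<open>ababa\<close> is not a cube, but its image, continued
  by the next letter, is \<open>(aba)(aba)(aba)\<close>. What is preserved is the condition that at least
  \<open>2 p - 1\<close> consecutive letters agree with the letters \<open>p\<close> places later, which is one letter
  short of a cube. So every such repetition descends to period \<open>1\<close>, that is, to an occurrence of
  \<open>aa\<close>. Its period is therefore a Fibonacci number \<open>fib (k + 2)\<close>, and it lies in the
  run that starts with the \<open>k\<close>-fold image of that occurrence (\<open>repetition_in_run\<close>) and has
  \<open>fib (k + 4) - 2\<close> letters that agree with their shifts.

  These letters always spell the same word, a prefix of the Fibonacci word
  (\<open>prefix_at_funpow_block_start\<close>). Hence all runs with one period contain the same cubes, and
  the first occurrences lie in the first run, which comes from the first \<open>aa\<close>, at position \<open>2\<close>,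
  and starts at \<open>fib (k + 3)\<close>. The cubes with root length \<open>fib (k + 2)\<close> in a prefix of length \<open>n\<close>
  thus correspond to the offsets in that run at which a cube fits into both the run and the prefix
  (\<open>cubes_in_prefix\<close>). Different offsets give different roots, because equality would be a
  repetition with a period that is too short for its length (\<open>fib_cube_roots_distinct\<close>).

  With \<open>j = k + 2\<close>, the run contains \<open>fib (j - 1) - 1\<close> cubes, the first of which ends at
  \<open>fib (j + 2) + 2 * fib j\<close>. The run is complete before the first cube of the next root length
  ends, so for each \<open>n\<close> at most one summand is partial, and the complete ones are summed by the
  identity for sums of consecutive Fibonacci numbers.
\<close>

section \<open>The Fibonacci word as a sequence of blocks\<close>

text \<open>
  Positions are counted from \<open>0\<close>. A constant of its own is used since the simplifier rewrites
  the stream operations at successor positions to expressions about tails.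
\<close>
definition F :: "nat \<Rightarrow> letter" where
  "F i = fib_word !! i"

definition block_start :: "nat \<Rightarrow> nat" where
  "block_start k = length (sigma_list (stake k fib_word))"

lemma fib_word_fixed: "flat (smap sigma fib_word) = fib_word" "shd fib_word = La"
  using theI'[OF fib_word_ex1] by (simp_all add: fib_word_def)

lemma fib_word_block_decomp:
  "fib_word = sigma_list (stake k fib_word) @- flat (smap sigma (sdrop k fib_word))"
  using flat_sigma_shift[of "stake k fib_word" "sdrop k fib_word"]
  by (simp add: stake_sdrop fib_word_fixed)

lemma snth_block_start:
  "F (block_start k + j) = flat (smap sigma (sdrop k fib_word)) !! j"
  unfolding F_def
  by (subst fib_word_block_decomp[of k]) (simp add: block_start_def shift_snth_ge)

lemma F_block_start [simp]: "F (block_start k) = La"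
  using snth_block_start[of k 0] by (cases "F k") (simp_all add: F_def)

lemma block_start_0 [simp]: "block_start 0 = 0"
  by (simp add: block_start_def sigma_list_def)

lemma block_start_Suc:
  "block_start (Suc k) = block_start k + (if F k = La then 2 else 1)"
  by (cases "F k") (simp_all add: F_def block_start_def stake_Suc sigma_list_def del: stake.simps)

lemma F_Suc_block_start: "F (Suc (block_start k)) = (if F k = La then Lb else La)"
proof (cases "F k")
  case La
  then show ?thesis using snth_block_start[of k 1] by (simp add: F_def)
next
  case Lb
  then show ?thesis using F_block_start[of "Suc k"] by (simp add: block_start_Suc)
qed

lemma letter_neq [simp]: "x \<noteq> La \<longleftrightarrow> x = Lb" "x \<noteq> Lb \<longleftrightarrow> x = La"
  by (cases x; simp)+

text \<open>
  Blocks have length \<open>1\<close> or \<open>2\<close>, and a second letter of a block is a \<open>b\<close>. This is what makes the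
  cutting unique: the \<open>a\<close>s are exactly the block starts.
\<close>
lemma position_in_block: "\<exists>k. i = block_start k \<or> i = Suc (block_start k) \<and> F k = La"
proof (induction i)
  case 0
  show ?case by (metis block_start_0)
next
  case (Suc i)
  then obtain k where "i = block_start k \<or> i = Suc (block_start k) \<and> F k = La" by blast
  then have "Suc i = block_start (Suc k) \<or> Suc i = Suc (block_start k) \<and> F k = La"
    by (cases "F k") (auto simp: block_start_Suc)
  then show ?case by blast
qed

lemma F_eq_LaE:
  assumes "F i = La" obtains k where "i = block_start k"
  using position_in_block[of i] assms F_Suc_block_start by auto

lemma F_eq_LbE:
  assumes "F i = Lb" obtains k where "i = Suc (block_start k)" "F k = La"
  using position_in_block[of i] assms by auto

lemma no_bb: "F i = Lb \<Longrightarrow> F (Suc i) = La"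
proof -
  assume "F i = Lb"
  then obtain k where "i = Suc (block_start k)" "F k = La" by (rule F_eq_LbE)
  then have "Suc i = block_start (Suc k)" by (simp add: block_start_Suc)
  then show ?thesis by simp
qed

text \<open>
  If \<open>aa\<close> occurs, its first letter is the image of a \<open>b\<close>, so its second letter opens the image
  of an \<open>a\<close>, as \<open>bb\<close> does not occur.
\<close>
lemma no_aaa: "F i = La \<Longrightarrow> F (Suc i) = La \<Longrightarrow> F (Suc (Suc i)) = Lb"
proof -
  assume i: "F i = La" "F (Suc i) = La"
  obtain k where k: "i = block_start k" using F_eq_LaE i(1) by blast
  then have Fk: "F k = Lb" using i(2) F_Suc_block_start[of k] by (auto split: if_splits)
  then have "Suc i = block_start (Suc k)" using k by (simp add: block_start_Suc)
  moreover have "F (Suc k) = La" using Fk no_bb by blast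
  ultimately show ?thesis using F_Suc_block_start[of "Suc k"] by simp
qed

lemma strict_mono_block_start: "strict_mono block_start"
  by (simp add: strict_mono_Suc_iff block_start_Suc)

lemma block_start_add_ge: "block_start k + j \<le> block_start (k + j)"
  by (induction j) (auto simp: block_start_Suc)

lemma block_start_add_2: "block_start k + 3 \<le> block_start (k + 2)"
  using no_bb[of k] by (cases "F k") (auto simp: block_start_Suc)

text \<open>
  The first \<open>x\<close> blocks contain \<open>x\<close> letters \<open>a\<close>, one each, and the image of a word is longer than
  the word by its number of \<open>a\<close>s. This one identity gives the Fibonacci recurrence for all
  iterated block starts.
\<close>
lemma block_start_block_start: "block_start (block_start k) = block_start k + k"
  by (induction k) (auto simp: block_start_Suc F_Suc_block_start)

lemma F_initial: "F 0 = La" "F 1 = Lb" "F 2 = La" "F 3 = La"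
  and block_start_initial: "block_start 1 = 2" "block_start 2 = 3"
proof -
  show 0: "F 0 = La" using F_block_start[of 0] by simp
  then show 1: "F 1 = Lb" using F_Suc_block_start[of 0] by simp
  then show 2: "F 2 = La" using no_bb[of 1] by (simp add: numeral_2_eq_2)
  show b1: "block_start 1 = 2" using block_start_Suc[of 0] 0 by simp
  show b2: "block_start 2 = 3" using block_start_Suc[of 1] 1 b1 by (simp add: numeral_2_eq_2)
  show "F 3 = La" using F_block_start[of 2] b2 by simp
qed

lemma block_start_fib: "block_start (fib (k + 2)) = fib (k + 3)"
proof (induction k)
  case 0
  show ?case using block_start_initial(1) by (simp add: numeral_eq_Suc)
next
  case (Suc k)
  have "block_start (fib (k + 3)) = fib (k + 3) + fib (k + 2)"
    using block_start_block_start[of "fib (k + 2)"] Suc by simp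
  then show ?case by (simp add: numeral_eq_Suc)
qed

lemma funpow_block_start_Suc_Suc:
  "(block_start ^^ Suc (Suc k)) i = (block_start ^^ Suc k) i + (block_start ^^ k) i"
  by (simp add: block_start_block_start)

text \<open>The \<open>k\<close>-fold image of the prefix \<open>ab\<close>, which precedes the first \<open>aa\<close>, has length \<open>fib (k + 3)\<close>.\<close>
lemma funpow_block_start_fib: "(block_start ^^ k) 2 = fib (k + 3)"
proof (induction k)
  case 0
  show ?case by (simp add: numeral_eq_Suc)
next
  case (Suc k)
  then show ?case using block_start_fib[of "k + 1"] by (simp add: numeral_eq_Suc)
qed

text \<open>The \<open>k\<close>-fold image of the letter \<open>a\<close> has length \<open>fib (k + 2)\<close>.\<close>
lemma funpow_block_start_step:
  assumes "F i = La"
  shows "(block_start ^^ k) (Suc i) = (block_start ^^ k) i + fib (k + 2)"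
proof (induction k rule: fib.induct)
  case 1
  show ?case by simp
next
  case 2
  show ?case using assms by (simp add: block_start_Suc numeral_eq_Suc)
next
  case (3 k)
  then show ?case
    unfolding funpow_block_start_Suc_Suc by simp
qed

lemma mono_block_start: "mono block_start"
  by (rule strict_mono_mono[OF strict_mono_block_start])

lemma mono_funpow_block_start: "i \<le> j \<Longrightarrow> (block_start ^^ k) i \<le> (block_start ^^ k) j"
  using mono_pow[OF mono_block_start] by (simp add: mono_def)

lemma fib_ge_1: "fib (Suc k) \<ge> 1"
  by (simp add: Suc_leI fib_neq_0_nat)

text \<open>
  The prefix of length \<open>fib (k + 4)\<close> ends in \<open>ab\<close> or \<open>ba\<close>, and the two endings alternate because
  the images \<open>aba\<close> and \<open>aab\<close> end in \<open>ba\<close> and \<open>ab\<close>. Both images have length \<open>3\<close>, whence the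
  position of the image of the shortened prefix.
\<close>
lemma last_two_letters_of_fib_prefix:
  "block_start (fib (k + 4) - 2) = fib (k + 5) - 3 \<and>
   F (fib (k + 4) - 2) \<noteq> F (fib (k + 4) - 1)"
proof (induction k)
  case 0
  have "fib 4 = 3" "fib 5 = 5" by (simp_all add: numeral_eq_Suc)
  then show ?case using F_initial block_start_initial by simp
next
  case (Suc k)
  define x where "x = fib (k + 4) - 2"
  have "fib 4 \<le> fib (k + 4)" by (rule fib_mono) simp
  moreover have "fib 4 = 3" by (simp add: numeral_eq_Suc)
  ultimately have x: "fib (k + 4) = Suc (Suc x)" by (simp add: x_def)
  have ne: "F x \<noteq> F (Suc x)" and bx: "block_start x = fib (k + 5) - 3"
    using Suc x by simp_all
  have e: "k + 2 + 2 = k + 4" "k + 2 + 3 = k + 5" "k + 3 + 2 = k + 5" "k + 3 + 3 = k + 6"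
    by simp_all
  have f5: "fib (k + 5) = block_start x + 3"
    using block_start_fib[of "k + 2", unfolded e x] ne
    by (cases "F x"; cases "F (Suc x)") (auto simp: block_start_Suc)
  have "F (Suc (block_start x)) \<noteq> F (Suc (Suc (block_start x)))"
    using ne F_Suc_block_start[of x] F_Suc_block_start[of "Suc x"] F_block_start[of "Suc x"]
      block_start_Suc[of x] by (cases "F x") auto
  then have n5: "F (fib (k + 5) - 2) \<noteq> F (fib (k + 5) - 1)" using f5 by simp
  define y where "y = fib (k + 5) - 2"
  have y: "fib (k + 5) = Suc (Suc y)" using f5 by (simp add: y_def)
  then have "fib (k + 6) = block_start y + 3"
    using block_start_fib[of "k + 3", unfolded e y] n5 y
    by (cases "F y"; cases "F (Suc y)") (auto simp: block_start_Suc)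
  moreover have "Suc k + 4 = k + 5" "Suc k + 5 = k + 6" by simp_all
  ultimately show ?case using n5 y by (simp only:) simp
qed

section \<open>Runs generated by an occurrence of \<open>aa\<close>\<close>

text \<open>
  The index \<open>u = block_start m\<close> is included: whatever letter follows the occurrence, its image
  begins with \<open>a\<close>. This is the extra letter by which repetitions grow.
\<close>
lemma sigma_image_of_prefix_occurrence:
  assumes "\<forall>t<m. F (x + t) = F t"
  shows "t \<le> m \<Longrightarrow> block_start (x + t) = block_start x + block_start t"
    and "u \<le> block_start m \<Longrightarrow> F (block_start x + u) = F u"
proof -
  have starts: "block_start (x + t) = block_start x + block_start t" if "t \<le> m" for t
    using that by (induction t) (use assms in \<open>auto simp: block_start_Suc\<close>)
  then show "t \<le> m \<Longrightarrow> block_start (x + t) = block_start x + block_start t" .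
  assume u: "u \<le> block_start m"
  obtain k where k: "u = block_start k \<or> u = Suc (block_start k) \<and> F k = La"
    using position_in_block by blast
  then have "block_start k \<le> block_start m" using u by auto
  then have "k \<le> m" by (simp add: strict_mono_less_eq[OF strict_mono_block_start])
  note bk = starts[OF this]
  from k show "F (block_start x + u) = F u"
  proof
    assume "u = block_start k"
    then show ?thesis using bk F_block_start by metis
  next
    assume uk: "u = Suc (block_start k) \<and> F k = La"
    then have "block_start k < block_start m" using u by simp
    then have "k < m" by (simp add: strict_mono_less[OF strict_mono_block_start])
    then have "F (x + k) = La" using assms uk by simp
    then show ?thesis
      using uk bk F_Suc_block_start[of k] F_Suc_block_start[of "x + k"] by simp
  qed
qed

text \<open>
  The guaranteed common prefix grows from \<open>fib (k + 4) - 2\<close> to its image plus one letter, which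
  has \<open>(fib (k + 5) - 3) + 1\<close> letters.
\<close>
lemma prefix_at_funpow_block_start:
  assumes "F i = La"
  shows "t < fib (k + 4) - 2 \<Longrightarrow> F ((block_start ^^ k) i + t) = F t"
proof (induction k arbitrary: t)
  case 0
  have "fib 4 = 3" by (simp add: numeral_eq_Suc)
  then show ?case using 0 assms F_initial by simp
next
  case (Suc k)
  have "fib 5 \<le> fib (k + 5)" by (rule fib_mono) simp
  moreover have "fib 5 = 5" by (simp add: numeral_eq_Suc)
  moreover have e: "Suc k + 4 = k + 5" by simp
  have "t < fib (k + 5) - 2" using Suc.prems unfolding e .
  ultimately have "t \<le> block_start (fib (k + 4) - 2)"
    using last_two_letters_of_fib_prefix[of k] by simp
  then show ?case
    using sigma_image_of_prefix_occurrence(2)[of "fib (k + 4) - 2" "(block_start ^^ k) i"] Suc.IH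
    by simp
qed

text \<open>
  The two adjacent letters \<open>a\<close> at positions \<open>2\<close> and \<open>3\<close> have images \<open>fib (k + 2)\<close> apart, and the
  same prefix is seen from both.
\<close>
lemma fib_prefix_period:
  assumes "t + fib (k + 2) < fib (k + 4) - 2"
  shows "F (t + fib (k + 2)) = F t"
proof -
  have "F ((block_start ^^ k) 2 + (t + fib (k + 2))) = F (t + fib (k + 2))"
    using prefix_at_funpow_block_start F_initial(3) assms by blast
  moreover have "F ((block_start ^^ k) 3 + t) = F t"
    using prefix_at_funpow_block_start F_initial(4) assms by auto
  moreover have "(block_start ^^ k) 3 = (block_start ^^ k) 2 + fib (k + 2)"
    using funpow_block_start_step[OF F_initial(3), of k] by (simp add: numeral_eq_Suc)
  ultimately show ?thesis by (simp add: ac_simps)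
qed

lemma run_periodic:
  assumes "F i = La" "F (Suc i) = La" "t < fib (k + 4) - 2"
  shows "F ((block_start ^^ k) i + t + fib (k + 2)) = F ((block_start ^^ k) i + t)"
  using prefix_at_funpow_block_start[OF assms(1,3)] prefix_at_funpow_block_start[OF assms(2,3)]
    funpow_block_start_step[OF assms(1), of k] by (simp add: ac_simps)

text \<open>
  The next two lemmas follow a run through one application of \<^term>\<open>sigma\<close>: where its end goes,
  and how its period grows. The second holds because sliding a window of length \<open>fib (k + 2)\<close>
  inside the run exchanges equal letters, so all these windows have images of the same length.
\<close>
lemma block_start_run_end:
  assumes "F i = La"
  shows "block_start ((block_start ^^ k) i + (fib (k + 4) - 2))
         = (block_start ^^ Suc k) i + (fib (k + 5) - 3)"
  using sigma_image_of_prefix_occurrence(1)[of "fib (k + 4) - 2" "(block_start ^^ k) i"]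
    prefix_at_funpow_block_start[OF assms] last_two_letters_of_fib_prefix[of k] by simp

lemma block_start_run_period:
  assumes "F i = La" "F (Suc i) = La"
    and "(block_start ^^ k) i \<le> a" "a \<le> (block_start ^^ k) i + (fib (k + 4) - 2)"
  shows "block_start (a + fib (k + 2)) = block_start a + fib (k + 3)"
  using assms(3,4)
proof (induction a rule: dec_induct)
  case base
  have "block_start ((block_start ^^ k) (Suc i)) = (block_start ^^ Suc k) (Suc i)" by simp
  also have "\<dots> = (block_start ^^ Suc k) i + fib (Suc k + 2)"
    by (rule funpow_block_start_step) fact
  finally show ?case using funpow_block_start_step[OF assms(1), of k]
    by (simp add: numeral_eq_Suc)
next
  case (step a)
  have "F (a + fib (k + 2)) = F a"
    using run_periodic[OF assms(1,2), of "a - (block_start ^^ k) i" k] step by simp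
  then show ?case using step by (simp add: block_start_Suc)
qed

section \<open>Every long repetition lies in a run\<close>

text \<open>
  If the repetition still sees the second position of the block of letter \<open>a + j\<close>, then it compares
  this position with the corresponding one in the block of letter \<open>b + j\<close>. That position tells
  which letter the block came from, so the two letters agree and the next blocks stay aligned.
\<close>
lemma repetition_desubstitute:
  assumes rep: "\<forall>t<M. F (block_start a + t) = F (block_start a + t + p)"
    and b: "block_start b = block_start a + p"
  shows "(\<forall>j<t. block_start (a + j) + 1 < block_start a + M) \<Longrightarrow>
    block_start (b + t) = block_start (a + t) + p \<and> (\<forall>j<t. F (a + j) = F (b + j))"
proof (induction t)
  case 0
  show ?case using b by simp
next
  case (Suc t)
  then have IH: "block_start (b + t) = block_start (a + t) + p" "\<forall>j<t. F (a + j) = F (b + j)"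
    by simp_all
  define u where "u = block_start (a + t) - block_start a"
  have "block_start a \<le> block_start (a + t)" using mono_block_start by (simp add: mono_def)
  then have u: "block_start (a + t) = block_start a + u" by (simp add: u_def)
  have "Suc u < M" using Suc.prems[rule_format, of t] u by simp
  then have "F (Suc (block_start (a + t))) = F (Suc (block_start (b + t)))"
    using rep[rule_format, of "Suc u"] IH u by (simp add: ac_simps)
  then have "F (a + t) = F (b + t)"
    by (simp add: F_Suc_block_start split: if_splits)
  then show ?case using IH by (auto simp: less_Suc_eq block_start_Suc)
qed

text \<open>
  By induction on the period. A repetition that begins with \<open>b\<close> can be extended by one letter to
  the left, so it may be assumed to begin at a block start \<open>block_start a\<close>; since \<open>b\<close> does not
  occur twice in a row, the period of the preimage is smaller. The bound \<open>2 * p - 1\<close> passes to the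
  preimage: two missing letters there would cost at least three letters in the image, but only two
  can be missing, namely the one below \<open>2 * p\<close> and the extra one on the right.
\<close>
lemma repetition_in_run:
  assumes "p \<ge> 1" "M \<ge> 2 * p - 1" "\<forall>t<M. F (s + t) = F (s + t + p)"
  shows "\<exists>k i. p = fib (k + 2) \<and> F i = La \<and> F (Suc i) = La \<and> (block_start ^^ k) i \<le> s \<and>
           s + M \<le> (block_start ^^ k) i + (fib (k + 4) - 2)"
  using assms
proof (induction p arbitrary: s M rule: less_induct)
  case (less p)
  show ?case
  proof (cases "p = 1")
    case True
    have "F s = F (Suc s)" using less.prems(2) less.prems(3)[rule_format, of 0] True by simp
    then have aa: "F s = La" "F (Suc s) = La" using no_bb[of s] by (cases "F s"; simp)+
    have "M < 2"
    proof (rule ccontr)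
      assume "\<not> M < 2"
      then have "F (Suc s) = F (Suc (Suc s))" using less.prems(3)[rule_format, of 1] True by simp
      then show False using no_aaa aa by simp
    qed
    moreover have "fib 4 = 3" by (simp add: numeral_eq_Suc)
    ultimately show ?thesis using aa True by (intro exI[of _ 0] exI[of _ s]) simp
  next
    case False
    then have p2: "p \<ge> 2" using less.prems(1) by simp
    have at_block: ?thesis
      if s: "s' = block_start a" "s' \<le> s" "s + M \<le> s' + M'" "M' \<ge> 2 * p - 1"
        and rep: "\<forall>t<M'. F (s' + t) = F (s' + t + p)" for s' a M'
    proof -
      have "F (s' + p) = La" using rep[rule_format, of 0] s p2 by simp
      then obtain b where b: "block_start b = block_start a + p" using F_eq_LaE s(1) by metis
      then have "block_start a < block_start b" using p2 by simp
      then have "a < b" by (simp add: strict_mono_less[OF strict_mono_block_start])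
      define q where "q = b - a"
      have q1: "q \<ge> 1" and bq: "b = a + q" using \<open>a < b\<close> by (simp_all add: q_def)
      note desub = repetition_desubstitute[of M' a p b, OF rep[unfolded s(1)] b]
      have "q < p"
      proof (cases "q = 1")
        case True
        then show ?thesis using p2 by simp
      next
        case False
        then obtain r where r: "q = r + 2" using q1 by (intro that[of "q - 2"]) simp
        have "block_start a + 3 + r \<le> block_start b"
          using block_start_add_2[of a] block_start_add_ge[of "a + 2" r] by (simp add: bq r ac_simps)
        then show ?thesis using b r by simp
      qed
      \<comment> \<open>the preimage ends before the first letter at whose block the repetition no longer
         compares the position after the block start, and so cannot identify the letter\<close>
      define N where "N = (LEAST t. s' + M' \<le> block_start (a + t) + 1)"
      have "s' + M' \<le> block_start (a + M') + 1" using block_start_add_ge[of a M'] s by simp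
      then have N: "s' + M' \<le> block_start (a + N) + 1"
        unfolding N_def by (rule LeastI)
      have below: "block_start (a + j) + 1 < block_start a + M'" if "j < N" for j
        using not_less_Least[of j "\<lambda>t. s' + M' \<le> block_start (a + t) + 1"] that s(1)
        by (simp add: N_def)
      \<comment> \<open>the repetition compares more than \<open>p\<close> positions, and the image of the first \<open>q\<close> letters
         has length \<open>p\<close>\<close>
      have Nq: "N \<ge> q"
      proof (rule ccontr)
        assume "\<not> N \<ge> q"
        then have "a + N < b" by (simp add: bq)
        then have "block_start (a + N) < block_start b"
          by (simp add: strict_mono_less[OF strict_mono_block_start])
        then have "s' + M' < s' + p + 1" using N b s(1) by simp
        then show False using s(4) p2 by simp
      qed
      \<comment> \<open>if \<open>N \<le> 2 q - 2\<close>, then the last two of the \<open>2 q\<close> letters, at least three letters of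
         the image, are missing\<close>
      have "N \<ge> 2 * q - 1"
      proof (rule ccontr)
        assume "\<not> N \<ge> 2 * q - 1"
        then have le: "a + N \<le> b + (q - 2) " and q2: "q \<ge> 2" using Nq by (auto simp: bq)
        have "block_start (b + q) = block_start b + p"
          using desub[of q] below Nq b bq by simp
        moreover have "block_start (b + (q - 2)) + 3 \<le> block_start (b + q)"
          using block_start_add_2[of "b + (q - 2)"] q2 by (simp only: add.assoc le_add_diff_inverse2)
        moreover have "block_start (a + N) \<le> block_start (b + (q - 2))"
          using le mono_block_start by (simp add: mono_def)
        ultimately show False using N b s p2 by simp
      qed
      moreover have "\<forall>t<N. F (a + t) = F (a + t + q)"
        using desub[of N] below by (simp add: bq ac_simps)
      ultimately obtain k i where ki: "q = fib (k + 2)" "F i = La" "F (Suc i) = La"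
        "(block_start ^^ k) i \<le> a" "a + N \<le> (block_start ^^ k) i + (fib (k + 4) - 2)"
        using less.IH[OF \<open>q < p\<close> q1] by blast
      have "p = fib (Suc k + 2)"
        using block_start_run_period[OF ki(2-4)] ki(1,5) b bq by (simp add: numeral_eq_Suc)
      moreover have "(block_start ^^ Suc k) i \<le> s"
        using monoD[OF mono_block_start ki(4)] s(1,2) by simp
      moreover have "s + M \<le> (block_start ^^ Suc k) i + (fib (Suc k + 4) - 2)"
      proof -
        have "fib 5 \<le> fib (k + 5)" by (rule fib_mono) simp
        moreover have "fib 5 = 5" by (simp add: numeral_eq_Suc)
        moreover have e: "Suc k + 4 = k + 5" by simp
        moreover have "s + M \<le> (block_start ^^ Suc k) i + (fib (k + 5) - 3) + 1"
          using monoD[OF mono_block_start ki(5)] block_start_run_end[OF ki(2), of k] N s(3)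
          by linarith
        ultimately show ?thesis unfolding e by linarith
      qed
      ultimately show ?thesis using ki(2,3) by blast
    qed
    show ?thesis
    proof (cases "F s")
      case La
      then obtain a where "s = block_start a" using F_eq_LaE by blast
      then show ?thesis using at_block less.prems by blast
    next
      case Lb
      then obtain a where a: "s = Suc (block_start a)" "F a = La" using F_eq_LbE by blast
      have "F (s + p) = Lb" using Lb less.prems(2) less.prems(3)[rule_format, of 0] p2 by simp
      then obtain b where b: "s + p = Suc (block_start b)" using F_eq_LbE by blast
      have "F (block_start a + t) = F (block_start a + t + p)" if "t < Suc M" for t
      proof (cases t)
        case 0
        have "block_start a + p = block_start b" using a(1) b by simp
        then show ?thesis using 0 F_block_start[of a] F_block_start[of b] by simp
      next
        case (Suc t')
        then show ?thesis using less.prems(3) that a(1) by simp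
      qed
      then show ?thesis
        using at_block[of "block_start a" a "Suc M"] a(1) less.prems(2) by simp
    qed
  qed
qed

section \<open>The cubes in a prefix\<close>

lemma sublist_fib_prefix_iff:
  "sublist u (stake n fib_word) \<longleftrightarrow>
   (\<exists>s. s + length u \<le> n \<and> u = map F [s..<s + length u])"
proof -
  have stake: "stake n fib_word = map F [0..<n]"
    by (rule nth_equalityI) (simp_all add: F_def)
  show ?thesis
  proof
    assume "sublist u (stake n fib_word)"
    then obtain ps ss where eq: "map F [0..<n] = ps @ u @ ss"
      unfolding sublist_def stake by blast
    have len: "n = length ps + length u + length ss"
      using arg_cong[OF eq, of length] by simp
    have "u ! t = F (length ps + t)" if "t < length u" for t
    proof -
      have "map F [0..<n] ! (length ps + t) = u ! t" using that by (simp add: eq nth_append)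
      then show ?thesis using that len by simp
    qed
    then have "u = map F [length ps..<length ps + length u]"
      by (intro nth_equalityI) simp_all
    then show "\<exists>s. s + length u \<le> n \<and> u = map F [s..<s + length u]"
      using len by (intro exI[of _ "length ps"]) simp
  next
    assume "\<exists>s. s + length u \<le> n \<and> u = map F [s..<s + length u]"
    then obtain s where s: "s + length u \<le> n" "u = map F [s..<s + length u]" by blast
    have "[0..<n] = [0..<s] @ [s..<s + length u] @ [s + length u..<n]"
      using upt_add_eq_append[of 0 s "n - s"] upt_add_eq_append[of s "s + length u" "n - s - length u"] s(1)
      by simp
    then have "stake n fib_word = map F [0..<s] @ u @ map F [s + length u..<n]"
      using s(2) by (simp add: stake)
    then show "sublist u (stake n fib_word)" unfolding sublist_def by blast
  qed
qed

lemma cube_in_prefix_iff: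
  "sublist (w @ w @ w) (stake n fib_word) \<longleftrightarrow>
   (\<exists>s. s + 3 * length w \<le> n \<and> w = map F [s..<s + length w] \<and>
        (\<forall>t<2 * length w. F (s + t) = F (s + t + length w)))"
proof -
  define p where "p = length w"
  have "w @ w @ w = map F [s..<s + 3 * p] \<longleftrightarrow>
        w = map F [s..<s + p] \<and> (\<forall>t<2 * p. F (s + t) = F (s + t + p))" (is "?L s \<longleftrightarrow> ?R s") for s
  proof -
    have "s + 3 * p = s + p + p + p" by simp
    moreover have "[s..<s + p + p + p] = [s..<s + p] @ [s + p..<s + p + p] @ [s + p + p..<s + p + p + p]"
      using upt_add_eq_append[of s "s + p" "p + p"] upt_add_eq_append[of "s + p" "s + p + p" p]
      by (simp add: add.assoc)
    ultimately have "?L s \<longleftrightarrow> w = map F [s..<s + p] \<and> w = map F [s + p..<s + p + p] \<and>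
        w = map F [s + p + p..<s + p + p + p]"
      by (simp only: map_append) (simp add: p_def)
    also have "\<dots> \<longleftrightarrow> w = map F [s..<s + p] \<and> (\<forall>t<p. F (s + t) = F (s + p + t)) \<and>
        (\<forall>t<p. F (s + p + t) = F (s + p + p + t))"
    proof -
      have "map F [a..<a + p] = map F [b..<b + p] \<longleftrightarrow> (\<forall>t<p. F (a + t) = F (b + t))" for a b
        by (simp add: list_eq_iff_nth_eq)
      note same = this
      show ?thesis unfolding same[symmetric] by auto
    qed
    also have "\<dots> \<longleftrightarrow> ?R s"
    proof -
      have "(\<forall>t<2 * p. F (s + t) = F (s + t + p)) \<longleftrightarrow>
        (\<forall>t<p. F (s + t) = F (s + t + p)) \<and> (\<forall>t<p. F (s + (p + t)) = F (s + (p + t) + p))"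
        (is "?l \<longleftrightarrow> ?r")
      proof
        assume r: ?r
        show ?l
        proof (intro allI impI)
          fix t assume "t < 2 * p"
          then show "F (s + t) = F (s + t + p)"
            using r[THEN conjunct1, rule_format, of t] r[THEN conjunct2, rule_format, of "t - p"]
            by (cases "t < p") simp_all
        qed
      qed simp
      then show ?thesis by (simp add: ac_simps)
    qed
    finally show ?thesis .
  qed
  note whole = this[unfolded p_def]
  have "length (w @ w @ w) = 3 * length w" by simp
  then show ?thesis unfolding sublist_fib_prefix_iff by (simp only: whole)
qed

text \<open>The length of the shortest prefix that contains a cube with root length \<open>fib j\<close>, for \<open>j \<ge> 4\<close>.\<close>
definition cube_onset :: "nat \<Rightarrow> nat" where
  "cube_onset j = fib (j + 2) + 2 * fib j"

text \<open>
  The offsets in the first run with period \<open>fib (k + 2)\<close> at which a cube begins that ends within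
  the first \<open>n\<close> letters. Since a cube needs \<open>2 * fib (k + 2)\<close> of the \<open>fib (k + 4) - 2\<close> agreeing
  letters, \<open>fib (k + 1) - 2\<close> is the largest offset.
\<close>
definition fib_cube_starts :: "nat \<Rightarrow> nat \<Rightarrow> nat set" where
  "fib_cube_starts n k = {i. i + 2 \<le> fib (k + 1) \<and> cube_onset (k + 2) + i \<le> n}"

lemma fib_expand: "fib (k + 2) = fib (k + 1) + fib k" "fib (k + 3) = 2 * fib (k + 1) + fib k"
  "fib (k + 4) = 3 * fib (k + 1) + 2 * fib k" "fib (k + 5) = 5 * fib (k + 1) + 3 * fib k"
  by (simp_all add: numeral_eq_Suc)

text \<open>
  An occurrence of a cube at offset \<open>d\<close> of any run can be moved to offset \<open>d\<close> of the first run,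
  which starts at \<open>fib (k + 3)\<close> and hence not later. As a run spells a prefix of the Fibonacci
  word, the root of the cube is the factor that begins at position \<open>d\<close> of the word.
\<close>
lemma cubes_in_prefix:
  "{w. w \<noteq> [] \<and> sublist (w @ w @ w) (stake n fib_word)} =
   (\<lambda>(k, i). map F [i..<i + fib (k + 2)]) ` (SIGMA k:UNIV. fib_cube_starts n k)" (is "?A = ?B")
proof (intro equalityI subsetI)
  fix w assume "w \<in> ?A"
  then obtain s where s: "w \<noteq> []" "s + 3 * length w \<le> n" "w = map F [s..<s + length w]"
      "\<forall>t<2 * length w. F (s + t) = F (s + t + length w)"
    by (auto simp: cube_in_prefix_iff)
  obtain k i where ki: "length w = fib (k + 2)" "F i = La" "F (Suc i) = La"
    "(block_start ^^ k) i \<le> s" "s + 2 * length w \<le> (block_start ^^ k) i + (fib (k + 4) - 2)"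
    using repetition_in_run[of "length w" "2 * length w" s] s(1,4) by (auto simp: Suc_le_eq)
  define d where "d = s - (block_start ^^ k) i"
  have d: "s = (block_start ^^ k) i + d" using ki(4) by (simp add: d_def)
  have pos: "fib (k + 1) \<ge> 1" using fib_ge_1[of k] by simp
  have "i \<ge> 2" using ki(2,3) F_initial by (cases "i = 0 \<or> i = 1") auto
  then have "fib (k + 3) \<le> (block_start ^^ k) i"
    using mono_funpow_block_start[of 2 i k] by (simp add: funpow_block_start_fib)
  then have "d \<in> fib_cube_starts n k"
    using ki(1,5) s(2) d pos by (simp add: fib_cube_starts_def cube_onset_def fib_expand add.assoc)
  moreover have "w = map F [d..<d + fib (k + 2)]"
  proof -
    have "F (s + t) = F (d + t)" if "t < length w" for t
      using prefix_at_funpow_block_start[OF ki(2), of "d + t" k] that ki(5) d by (simp add: add.assoc)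
    then show ?thesis using s(3) ki(1) by (auto simp: list_eq_iff_nth_eq)
  qed
  ultimately show "w \<in> ?B" by force
next
  fix w assume "w \<in> ?B"
  then obtain k i where i: "i + 2 \<le> fib (k + 1)" "cube_onset (k + 2) + i \<le> n"
    and w: "w = map F [i..<i + fib (k + 2)]"
    by (auto simp: fib_cube_starts_def)
  have p: "fib (k + 2) \<ge> 1" using fib_ge_1[of "k + 1"] by simp
  define s where "s = fib (k + 3) + i"
  have per: "F (s + t) = F (s + t + fib (k + 2))" if "t < 2 * fib (k + 2)" for t
  proof -
    have "F (Suc 2) = La" using F_initial(4) by simp
    moreover have "i + t < fib (k + 4) - 2" using that i(1) by (simp add: fib_expand)
    ultimately show ?thesis
      using run_periodic[OF F_initial(3), of "i + t" k]
      by (simp only: s_def funpow_block_start_fib ac_simps)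
  qed
  have eq: "F (s + t) = F (i + t)" if "t < fib (k + 2)" for t
    using prefix_at_funpow_block_start[OF F_initial(3), of "i + t" k] that i(1)
    by (simp add: s_def funpow_block_start_fib fib_expand ac_simps)
  have "w = map F [s..<s + length w]" using eq w by (auto simp: list_eq_iff_nth_eq)
  moreover have "s + 3 * length w \<le> n"
    using i(2) w by (simp add: s_def cube_onset_def fib_expand add.assoc)
  ultimately show "w \<in> ?A" using per p w by (auto simp: cube_in_prefix_iff)
qed

lemma fib_less_imp_less: "fib a < fib b \<Longrightarrow> a < b"
  using fib_mono[of b a] by (meson linorder_not_le)

text \<open>
  If the roots at two offsets with difference \<open>d\<close> were equal, then \<open>2 * fib (k + 2)\<close> letters would
  agree with the letters \<open>d\<close> places later. So \<open>d\<close> would be a smaller Fibonacci number, but a run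
  with a smaller period has fewer than \<open>fib (k + 3)\<close> agreeing letters, hence fewer than
  \<open>2 * fib (k + 2)\<close>.
\<close>
lemma fib_cube_roots_distinct:
  assumes "i < i'" "i' + 2 \<le> fib (k + 1)"
  shows "map F [i..<i + fib (k + 2)] \<noteq> map F [i'..<i' + fib (k + 2)]"
proof
  let ?p = "fib (k + 2)"
  assume eq: "map F [i..<i + ?p] = map F [i'..<i' + ?p]"
  define d where "d = i' - i"
  have first: "F (i + t) = F (i' + t)" if "t < ?p" for t
    using arg_cong[OF eq, of "\<lambda>u. u ! t"] that by simp
  have per: "F (j + t + ?p) = F (j + t)" if "j \<le> i'" "t < ?p" for j t
    using fib_prefix_period[of "j + t" k] that assms(2) by (simp add: fib_expand)
  have "F (i + t) = F (i + t + d)" if "t < 2 * ?p" for t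
  proof (cases "t < ?p")
    case True
    then show ?thesis using first[of t] assms(1) by (simp add: d_def add.commute)
  next
    case False
    then show ?thesis
      using first[of "t - ?p"] per[of i "t - ?p"] per[of i' "t - ?p"] that assms(1)
      by (simp add: d_def add.commute)
  qed
  moreover have d: "d \<ge> 1" "d < ?p" using assms by (auto simp: d_def fib_expand)
  moreover have "2 * d - 1 \<le> 2 * ?p" using d(2) by linarith
  ultimately obtain l a where l: "d = fib (l + 2)" and a: "(block_start ^^ l) a \<le> i"
      "i + 2 * ?p \<le> (block_start ^^ l) a + (fib (l + 4) - 2)"
    using repetition_in_run[of d "2 * ?p" i] by blast
  have "l + 2 < k + 2" using d(2) l fib_less_imp_less by metis
  then have "fib (l + 4) \<le> fib (k + 3)" by (intro fib_mono) simp
  moreover have "2 * ?p \<le> fib (l + 4) - 2" using a by linarith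
  moreover have "fib (k + 1) \<ge> 1" using fib_ge_1[of k] by simp
  ultimately show False by (simp add: fib_expand)
qed

lemma inj_on_fib_cube_roots:
  "inj_on (\<lambda>(k, i). map F [i..<i + fib (k + 2)]) (SIGMA k:UNIV. fib_cube_starts n k)"
proof (rule inj_onI, clarify)
  fix k i k' i'
  assume i: "i \<in> fib_cube_starts n k" "i' \<in> fib_cube_starts n k'"
    and eq: "map F [i..<i + fib (k + 2)] = map F [i'..<i' + fib (k' + 2)]"
  have len: "fib (k + 2) = fib (k' + 2)" using arg_cong[OF eq, of length] by simp
  have less: "fib (a + 2) < fib (b + 2)" if "a < b" for a b
  proof -
    have "fib (a + 2) < fib (a + 3)" using fib_ge_1[of a] by (simp add: fib_expand)
    also have "\<dots> \<le> fib (b + 2)" using that by (intro fib_mono) simp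
    finally show ?thesis .
  qed
  have "k = k'" using less[of k k'] less[of k' k] len by (cases k k' rule: linorder_cases) simp_all
  then show "k = k' \<and> i = i'"
    using fib_cube_roots_distinct[of i i' k] fib_cube_roots_distinct[of i' i k] i eq
    by (cases i i' rule: linorder_cases) (auto simp: fib_cube_starts_def)
qed

section \<open>Counting\<close>

lemma strict_mono_cube_onset: "strict_mono cube_onset"
proof (unfold strict_mono_Suc_iff, intro allI)
  fix j
  have "fib j \<le> fib (j + 1)" "fib (j + 1) \<ge> 1" using fib_mono[of j "j + 1"] fib_ge_1[of j] by simp_all
  moreover have "Suc j + 2 = j + 3" "Suc j = j + 1" by simp_all
  ultimately show "cube_onset j < cube_onset (Suc j)"
    unfolding cube_onset_def by (simp only: fib_expand)
qed

lemma card_fib_cube_starts: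
  "card (fib_cube_starts n k) = min (fib (k + 1) - 1) (n + 1 - cube_onset (k + 2))"
proof -
  have "fib_cube_starts n k = {..<min (fib (k + 1) - 1) (n + 1 - cube_onset (k + 2))}"
    by (auto simp: fib_cube_starts_def)
  then show ?thesis by simp
qed

lemma cube_count_eq_sum:
  assumes "n < cube_onset (K + 2)"
  shows "cube_count n = (\<Sum>k<K. min (fib (k + 1) - 1) (n + 1 - cube_onset (k + 2)))"
proof -
  have "fib_cube_starts n k = {}" if "\<not> k < K" for k
    using strict_mono_less_eq[OF strict_mono_cube_onset, of "K + 2" "k + 2"] that assms
    by (auto simp: fib_cube_starts_def)
  then have S: "(SIGMA k:UNIV. fib_cube_starts n k) = (SIGMA k:{..<K}. fib_cube_starts n k)"
    by auto
  have fin: "finite (fib_cube_starts n k)" for k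
    by (rule finite_subset[of _ "{..n}"]) (auto simp: fib_cube_starts_def)
  have "cube_count n = card (SIGMA k:UNIV. fib_cube_starts n k)"
    unfolding cube_count_def cubes_in_prefix by (rule card_image[OF inj_on_fib_cube_roots])
  also have "\<dots> = (\<Sum>k<K. card (fib_cube_starts n k))"
    unfolding S by (rule card_SigmaI) (use fin in simp_all)
  finally show ?thesis by (simp only: card_fib_cube_starts)
qed

lemma sum_fib_minus_1: "(\<Sum>k<K. fib (k + 1) - 1) + K + 1 = fib (K + 2)"
proof (induction K)
  case (Suc K)
  have "fib (K + 1) \<ge> 1" using fib_ge_1[of K] by simp
  moreover have "Suc K + 2 = K + 3" by simp
  ultimately show ?case using Suc by (simp only: sum.lessThan_Suc fib_expand)
qed simp

text \<open>
  For these \<open>n\<close>, all cubes with root length below \<open>fib (K + 2)\<close> are present, because the last of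
  them ends before the first one with root length \<open>fib (K + 2)\<close> can, and no cube with a larger
  root is complete. Only the summand for \<open>k = K\<close> depends on \<open>n\<close>.
\<close>
lemma cube_count_closed_form:
  assumes "cube_onset (K + 2) \<le> n" "n < cube_onset (K + 3)"
  shows "cube_count n + K + 1 = fib (K + 2) + min (fib (K + 1) - 1) (n + 1 - cube_onset (K + 2))"
proof -
  have "min (fib (k + 1) - 1) (n + 1 - cube_onset (k + 2)) = fib (k + 1) - 1" if "k < K" for k
  proof -
    have "cube_onset (k + 3) \<le> n"
      using strict_mono_less_eq[OF strict_mono_cube_onset, of "k + 3" "K + 2"] that assms(1) by simp
    moreover have e: "k + 3 + 2 = k + 5" "k + 2 + 2 = k + 4" by simp_all
    have "cube_onset (k + 3) = 9 * fib (k + 1) + 5 * fib k"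
      "cube_onset (k + 2) = 5 * fib (k + 1) + 4 * fib k"
      unfolding cube_onset_def e fib_expand by simp_all
    ultimately have "cube_onset (k + 2) + fib (k + 1) \<le> n" by linarith
    then show ?thesis by linarith
  qed
  then have "cube_count n = (\<Sum>k<K. fib (k + 1) - 1) + min (fib (K + 1) - 1) (n + 1 - cube_onset (K + 2))"
    using cube_count_eq_sum[of n "Suc K"] assms(2) by (simp add: numeral_eq_Suc)
  then show ?thesis using sum_fib_minus_1[of K] by linarith
qed

lemma cube_onset_4: "cube_onset 4 = 14"
  by (simp add: cube_onset_def numeral_eq_Suc)

lemma cube_onset_fibnum:
  assumes "m \<ge> - 1"
  shows "fibnum (m + 1) + 2 * fibnum (m - 1) = int (cube_onset (nat (m + 1)))"
    and "fibnum (m + 2) + 2 * fibnum m = int (cube_onset (nat (m + 1) + 1))"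
proof -
  have "nat (m + 1 + 2) = nat (m + 1) + 2" "nat (m - 1 + 2) = nat (m + 1)"
    "nat (m + 2 + 2) = nat (m + 1) + 1 + 2" "nat (m + 2) = nat (m + 1) + 1"
    using assms by linarith+
  then show "fibnum (m + 1) + 2 * fibnum (m - 1) = int (cube_onset (nat (m + 1)))"
    "fibnum (m + 2) + 2 * fibnum m = int (cube_onset (nat (m + 1) + 1))"
    unfolding fibnum_def cube_onset_def by simp_all
qed

lemma cube_onset_interval_ex1:
  assumes "n \<ge> 1"
  shows "\<exists>!j. cube_onset j \<le> n \<and> n < cube_onset (j + 1)"
proof (rule ex_ex1I)
  define j where "j = (LEAST j. n < cube_onset (j + 1))"
  have "n + 1 \<le> cube_onset (n + 1)" by (rule strict_mono_imp_increasing[OF strict_mono_cube_onset])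
  then have "n < cube_onset (n + 1)" by simp
  then have "n < cube_onset (j + 1)" unfolding j_def by (rule LeastI)
  moreover have "cube_onset j \<le> n"
  proof (cases j)
    case 0
    then show ?thesis using assms by (simp add: cube_onset_def)
  next
    case (Suc i)
    then have "i < (LEAST j. n < cube_onset (j + 1))" by (simp add: j_def)
    then show ?thesis using not_less_Least[of i "\<lambda>j. n < cube_onset (j + 1)"] Suc by simp
  qed
  ultimately show "\<exists>j. cube_onset j \<le> n \<and> n < cube_onset (j + 1)" by blast
next
  fix i j
  assume i: "cube_onset i \<le> n \<and> n < cube_onset (i + 1)"
    and j: "cube_onset j \<le> n \<and> n < cube_onset (j + 1)"
  then have "cube_onset i < cube_onset (j + 1)" "cube_onset j < cube_onset (i + 1)" by linarith+
  then have "i < j + 1" "j < i + 1" by (simp_all only: strict_mono_less[OF strict_mono_cube_onset])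
  then show "i = j" by simp
qed

theorem theorem8p3:
  fixes n :: nat
  assumes "n \<ge> 1"
  shows "(n < 14 \<longrightarrow> cube_count n = 0) \<and>
    (n \<ge> 14 \<longrightarrow>
      (\<exists>!m::int. m \<ge> - 1 \<and> fibnum (m + 1) + 2 * fibnum (m - 1) \<le> int n \<and>
                 int n \<le> fibnum (m + 2) + 2 * fibnum m - 1) \<and>
      (\<forall>m::int. m \<ge> - 1 \<and> fibnum (m + 1) + 2 * fibnum (m - 1) \<le> int n \<and>
                int n \<le> fibnum (m + 2) + 2 * fibnum m - 1 \<longrightarrow>
         m \<ge> 3 \<and>
         int (cube_count n) =
           (if int n \<le> 2 * fibnum (m + 1) - 2
            then int n - fibnum (m + 1) - fibnum (m - 1) - m + 1
            else fibnum m - m - 1)))"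
proof (intro conjI impI allI)
  assume "n < 14"
  then show "cube_count n = 0"
    using cube_count_eq_sum[of n 2] cube_onset_4 by (simp add: lessThan_nat_numeral)
next
  let ?I = "\<lambda>m::int. m \<ge> - 1 \<and> fibnum (m + 1) + 2 * fibnum (m - 1) \<le> int n \<and>
    int n \<le> fibnum (m + 2) + 2 * fibnum m - 1"
  let ?J = "\<lambda>j. cube_onset j \<le> n \<and> n < cube_onset (j + 1)"
  have IJ: "?I m \<longleftrightarrow> m \<ge> - 1 \<and> ?J (nat (m + 1))" for m
    using cube_onset_fibnum[of m] by auto
  assume n: "n \<ge> 14"
  obtain j where j: "?J j" "\<And>i. ?J i \<Longrightarrow> i = j" using cube_onset_interval_ex1[OF assms] by blast
  show "\<exists>!m. ?I m"
  proof (rule ex1I)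
    show "?I (int j - 1)" using j(1) IJ[of "int j - 1"] by simp
    show "m = int j - 1" if "?I m" for m
    proof -
      have "nat (m + 1) = j" using that j(2) IJ[of m] by blast
      then show ?thesis using that by linarith
    qed
  qed
next
  fix m :: int
  assume n: "n \<ge> 14"
    and m: "m \<ge> - 1 \<and> fibnum (m + 1) + 2 * fibnum (m - 1) \<le> int n \<and>
      int n \<le> fibnum (m + 2) + 2 * fibnum m - 1"
  define j where "j = nat (m + 1)"
  have j: "cube_onset j \<le> n" "n < cube_onset (j + 1)"
    using m cube_onset_fibnum[of m] by (auto simp: j_def)
  have "cube_onset 4 < cube_onset (j + 1)" using n j(2) by (simp add: cube_onset_4)
  then have "4 < j + 1" by (simp only: strict_mono_less[OF strict_mono_cube_onset])
  then show "m \<ge> 3" by (simp add: j_def)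
  then obtain K where K: "j = K + 2" "m = int K + 1"
    by (intro that[of "j - 2"]) (auto simp: j_def)
  have f: "fibnum (m + 1) = int (fib (K + 4))" "fibnum (m - 1) = int (fib (K + 2))"
    "fibnum m = int (fib (K + 3))"
    using K(2) by (simp_all add: fibnum_def nat_add_distrib add.commute)
  \<comment> \<open>in these terms the case distinction of the formula is whether \<open>r + 1 \<le> c\<close>: of the \<open>c\<close> cubes
     with root length \<open>fib (K + 2)\<close>, \<open>r + 1\<close> would be complete if the run did not end\<close>
  obtain c where c: "fib (K + 1) = c + 1"
    using fib_ge_1[of K] by (intro that[of "fib (K + 1) - 1"]) simp
  have onset: "cube_onset (K + 2) = fib (K + 4) + 2 * fib (K + 2)"
    unfolding cube_onset_def add.assoc by (simp only: numeral_plus_numeral add_num_simps)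
  obtain r where r: "n = cube_onset (K + 2) + r" using j(1) K(1) le_Suc_ex by blast
  have "cube_count n + K + 1 = fib (K + 2) + min c (r + 1)"
    using cube_count_closed_form[of K n] j unfolding K(1) add.assoc r c by simp
  then have count: "int (cube_count n) = int (fib (K + 2)) + int (min c (r + 1)) - int K - 1"
    by linarith
  show "int (cube_count n) =
           (if int n \<le> 2 * fibnum (m + 1) - 2
            then int n - fibnum (m + 1) - fibnum (m - 1) - m + 1
            else fibnum m - m - 1)"
    unfolding f count unfolding r onset fib_expand c unfolding K(2) by (cases "r + 1 \<le> c") auto
qed

end
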